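(* Let $0<\theta<\pi$ with $\theta\neq\pi/2$, and suppose $\tan\theta$ is algebraic over $\mathbb{Q}$. Then there is a constant $c_\theta>0$ (depending only on $\theta$) such that for every integer $n\ge 3$ there exists a set $P$ of at most $n$ points in the Euclidean plane for which the number of triples of $P$ determining the angle $\theta$ is at least $c_\theta\, n^2\ln n$. In other words, the maximum number of triples determining angle $\theta$ among $n$ points in the plane is $\Omega_\theta(n^2\log n)$.
   Context: A triple $(p,q,r)$ of distinct points of the plane is said to determine the angle $\theta$ if the angle $\angle qpr$ (the angle at the vertex $p$ between the rays $pq$ and $pr$) has measure $\theta$. *)

theory Defs
  imports "HOL-Analysis.Analysis" "HOL-Computational_Algebra.Polynomial"
begin

definition vec_angle :: "real^2 \<Rightarrow> real^2 \<Rightarrow> real" where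
  "vec_angle u v = arccos ((u \<bullet> v) / (norm u * norm v))"

definition determines_angle :: "real \<Rightarrow> real^2 \<Rightarrow> real^2 \<Rightarrow> real^2 \<Rightarrow> bool" where
  "determines_angle \<theta> p q r \<longleftrightarrow>
     p \<noteq> q \<and> p \<noteq> r \<and> q \<noteq> r \<and> vec_angle (q - p) (r - p) = \<theta>"

definition angle_triples :: "real \<Rightarrow> (real^2) set \<Rightarrow> nat" where
  "angle_triples \<theta> P = card {(p, q, r). p \<in> P \<and> q \<in> P \<and> r \<in> P \<and> determines_angle \<theta> p q r}"

end

theory Submission
  imports Defs
begin

text \<open>
  With \<open>\<alpha> = tan \<theta>\<close> and \<open>m \<alpha>\<close> an algebraic integer, let \<open>R = \<int>[m \<alpha>]\<close>, a free module of rank \<open>d\<close>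
  normed by the largest coefficient, and take for \<open>P\<close> the points whose two coordinates lie in a box
  of \<open>R\<close>.  Rotation by \<open>\<theta>\<close> followed by a suitable scaling is multiplication by \<open>m (1 + i \<alpha>)\<close>,
  which preserves \<open>R\<^sup>2\<close>.  Hence every ratio \<open>l / n\<close> with \<open>l, n\<close> positive elements of \<open>R\<close> of size
  \<open>L\<close> yields about \<open>(N / L)\<^bsup>2d\<^esup>\<close> pairs of vectors \<open>n w\<close>, \<open>\<plusminus> l m (1 + i \<alpha>) w\<close> in a box of size \<open>N\<close>
  that enclose the angle \<open>\<theta>\<close>.

  It remains to find, at each of about \<open>ln N\<close> geometric scales \<open>L\<close>, at least \<open>L\<^bsup>2d\<^esup>\<close> ratios that do
  not occur at a smaller scale.  No ideal theory is needed: a ratio \<open>t\<close> that does occur at a scale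
  smaller by the factor \<open>s\<close> has at most about \<open>s\<^sup>d\<close> times as many representations at scale \<open>L\<close>
  as it has there, whereas the total number of pairs \<open>(l, n)\<close> grows by \<open>s\<^bsup>2d\<^esup>\<close>.
  So for a large constant \<open>s\<close> most pairs have a new ratio, and a new ratio has boundedly many
  representations.
\<close>

section \<open>Counting new ratios in a normed order\<close>

text \<open>The model is \<open>\<int>[b]\<close> with a \<open>\<int>\<close>-basis of
  \<open>d\<close> elements and \<open>nm\<close> the largest coefficient in absolute value. One
  constant \<open>C\<close> bounds both products and real absolute values; the rank enters only
  through the size of a box.\<close>

locale normed_order =
  fixes R :: "real set" and nm :: "real \<Rightarrow> nat" and d C :: nat
  assumes one_mem: "1 \<in> R"
    and add_mem: "x \<in> R \<Longrightarrow> y \<in> R \<Longrightarrow> x + y \<in> R"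
    and minus_mem: "x \<in> R \<Longrightarrow> - x \<in> R"
    and mult_mem: "x \<in> R \<Longrightarrow> y \<in> R \<Longrightarrow> x * y \<in> R"
    and nm_one: "nm 1 \<le> 1"
    and nm_add: "x \<in> R \<Longrightarrow> y \<in> R \<Longrightarrow> nm (x + y) \<le> nm x + nm y"
    and nm_minus: "x \<in> R \<Longrightarrow> nm (- x) = nm x"
    and nm_of_nat_mult: "x \<in> R \<Longrightarrow> nm (of_nat k * x) = k * nm x"
    and nm_mult: "x \<in> R \<Longrightarrow> y \<in> R \<Longrightarrow> nm (x * y) \<le> C * nm x * nm y"
    and abs_le_nm: "x \<in> R \<Longrightarrow> \<bar>x\<bar> \<le> real C * real (nm x)"
    and card_nm_le: "card {x \<in> R. nm x \<le> N} = (2 * N + 1) ^ d"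
    and d_pos: "d \<ge> 1" and C_pos: "C \<ge> 1"
begin

section \<open>Arithmetic of boxes\<close>

definition Box :: "nat \<Rightarrow> real set" where
  "Box N = {x \<in> R. nm x \<le> N}"

lemma card_Box: "card (Box N) = (2 * N + 1) ^ d"
  unfolding Box_def by (rule card_nm_le)

lemma finite_Box [simp]: "finite (Box N)"
  using card_Box[of N] by (intro card_ge_0_finite) simp

lemma Box_mono: "M \<le> N \<Longrightarrow> Box M \<subseteq> Box N"
  by (auto simp: Box_def)

lemma zero_mem: "0 \<in> R"
  using add_mem[OF one_mem minus_mem[OF one_mem]] by simp

lemma diff_mem: "x \<in> R \<Longrightarrow> y \<in> R \<Longrightarrow> x - y \<in> R"
  using add_mem[of x "- y"] minus_mem[of y] by simp

lemma nm_diff: "x \<in> R \<Longrightarrow> y \<in> R \<Longrightarrow> nm (x - y) \<le> nm x + nm y"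
  using nm_add[of x "- y"] minus_mem[of y] nm_minus[of y] by simp

lemma nm_zero: "nm 0 = 0"
  using nm_of_nat_mult[OF one_mem, of 0] by simp

lemma of_nat_mem: "of_nat k \<in> R"
  by (induction k) (auto intro: add_mem one_mem zero_mem)

lemma nm_of_nat: "nm (of_nat k) \<le> k"
  using nm_of_nat_mult[OF one_mem, of k] nm_one by simp

lemma zero_in_Box [simp]: "0 \<in> Box N"
  by (simp add: Box_def zero_mem nm_zero)

lemma Box_add: "x \<in> Box M \<Longrightarrow> y \<in> Box N \<Longrightarrow> x + y \<in> Box (M + N)"
  unfolding Box_def using nm_add[of x y] by (auto intro: add_mem)

lemma Box_diff: "x \<in> Box M \<Longrightarrow> y \<in> Box N \<Longrightarrow> x - y \<in> Box (M + N)"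
  unfolding Box_def using nm_diff[of x y] by (auto intro: diff_mem)

lemma Box_minus: "x \<in> Box M \<Longrightarrow> - x \<in> Box M"
  unfolding Box_def using nm_minus[of x] by (auto intro: minus_mem)

lemma Box_mult:
  assumes "x \<in> Box M" "y \<in> Box N" shows "x * y \<in> Box (C * M * N)"
proof -
  have "nm (x * y) \<le> C * nm x * nm y" using assms nm_mult by (auto simp: Box_def)
  also have "\<dots> \<le> C * M * N" using assms by (intro mult_mono) (auto simp: Box_def)
  finally show ?thesis using assms mult_mem by (auto simp: Box_def)
qed

section \<open>Denominators of a ratio\<close>

text \<open>The possible denominators of \<open>t\<close>, together with 0. Closure under
  subtraction is the structure that the counting exploits.\<close>

definition ring_part :: "real \<Rightarrow> real set" where
  "ring_part t = {x \<in> R. t * x \<in> R}"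

lemma ring_part_diff: "x \<in> ring_part t \<Longrightarrow> y \<in> ring_part t \<Longrightarrow> x - y \<in> ring_part t"
  by (auto simp: ring_part_def right_diff_distrib intro: diff_mem)

text \<open>Averaging over the translates of a box replaces a covering by disjoint smaller boxes.\<close>

lemma card_le_ring_part:
  assumes S: "S \<subseteq> ring_part t" and near: "\<And>x. x \<in> S \<Longrightarrow> x - a \<in> Box (s * L)"
  shows "card S \<le> (s + 1) ^ d * card (ring_part t \<inter> Box (2 * L))"
proof -
  \<comment> \<open>\<open>g\<close> depends only on the translated point \<open>m + x\<close>. The
    difference \<open>m - g (m + x)\<close> is then a small element of
    \<open>ring_part t\<close>.\<close>
  define g where "g y = (SOME m. m \<in> S \<and> y - m \<in> Box L)" for y
  have g: "g (m + x) \<in> S \<and> m + x - g (m + x) \<in> Box L" if "m \<in> S" "x \<in> Box L" for m x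
    unfolding g_def by (rule someI[of _ m]) (use that in simp)
  \<comment> \<open>The first component determines \<open>m + x\<close>, hence
    \<open>g (m + x)\<close>; the second then gives back \<open>m\<close>.\<close>
  let ?f = "\<lambda>(m, x). (m - a + x, m - g (m + x))"
  have inj: "inj_on ?f (S \<times> Box L)"
  proof (rule inj_onI, clarify)
    fix m x m' x'
    assume 1: "m - a + x = m' - a + x'" and 2: "m - g (m + x) = m' - g (m' + x')"
    from 1 have "m + x = m' + x'" by simp
    with 2 show "m = m' \<and> x = x'" by simp
  qed
  have sub: "?f ` (S \<times> Box L) \<subseteq> Box (s * L + L) \<times> (ring_part t \<inter> Box (2 * L))"
  proof (rule image_subsetI, clarify)
    fix m x assume m: "m \<in> S" and x: "x \<in> Box L"
    have "m - a + x \<in> Box (s * L + L)" by (rule Box_add[OF near[OF m] x])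
    moreover have "m - g (m + x) \<in> ring_part t" using g[OF m x] m S by (blast intro: ring_part_diff)
    moreover have "m - g (m + x) \<in> Box (2 * L)"
      using Box_diff[OF conjunct2[OF g[OF m x]] x] by (simp add: mult_2)
    ultimately show "m - a + x \<in> Box (s * L + L) \<and> m - g (m + x) \<in> ring_part t \<inter> Box (2 * L)"
      by simp
  qed
  have "card (S \<times> Box L) \<le> card (Box (s * L + L) \<times> (ring_part t \<inter> Box (2 * L)))"
    by (rule card_inj_on_le[OF inj sub]) simp
  hence "card S * (2 * L + 1) ^ d
      \<le> (2 * (s * L + L) + 1) ^ d * card (ring_part t \<inter> Box (2 * L))"
    by (simp only: card_cartesian_product card_Box)
  \<comment> \<open>The enlarged box has at most \<open>(s + 1) ^ d\<close> times as many elements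
    as \<open>Box L\<close>, so the factor \<open>(2 * L + 1) ^ d\<close> cancels.\<close>
  also have "\<dots> \<le> ((s + 1) * (2 * L + 1)) ^ d * card (ring_part t \<inter> Box (2 * L))"
    by (intro mult_right_mono power_mono) (auto simp: algebra_simps)
  finally have "card S * (2 * L + 1) ^ d
      \<le> ((s + 1) ^ d * card (ring_part t \<inter> Box (2 * L))) * (2 * L + 1) ^ d"
    by (simp only: power_mult_distrib mult_ac)
  thus ?thesis by (subst (asm) mult_le_cancel2) simp
qed

text \<open>
  The value of \<open>s\<close> makes the pairs with an old ratio at most half of all pairs.  Elements of
  \<open>near L\<close> differ from a natural number by so little that they are positive and that division by
  them is bounded for \<open>nm\<close>.
\<close>

definition s :: nat where "s = 130 * C"

definition near :: "nat \<Rightarrow> real set" where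
  "near L = {x. x - of_nat (2 * C * s * L) \<in> Box (s * L)}"

lemma near_mem: "x \<in> near L \<Longrightarrow> x \<in> R"
  using add_mem[OF _ of_nat_mem[of "2 * C * s * L"], of "x - of_nat (2 * C * s * L)"]
  by (simp add: near_def Box_def del: of_nat_mult)

lemma nm_near:
  assumes "x \<in> near L" shows "nm x \<le> 3 * C * s * L"
proof -
  let ?h = "of_nat (2 * C * s * L) :: real"
  have "nm ((x - ?h) + ?h) \<le> nm (x - ?h) + nm ?h"
    using assms by (intro nm_add of_nat_mem) (simp add: near_def Box_def del: of_nat_mult)
  also have "\<dots> \<le> s * L + 2 * C * s * L"
    using assms by (intro add_mono nm_of_nat) (simp add: near_def Box_def del: of_nat_mult)
  also have "s * L \<le> C * s * L" using C_pos by simp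
  finally show ?thesis by (simp add: mult_ac)
qed

lemma near_pos:
  assumes "x \<in> near L" "L \<ge> 1" shows "x > 0"
proof -
  let ?h = "of_nat (2 * C * s * L) :: real"
  have "\<bar>x - ?h\<bar> \<le> real C * real (nm (x - ?h))"
    using assms by (intro abs_le_nm) (auto simp: near_def Box_def)
  also have "\<dots> \<le> real C * real (s * L)"
    using assms by (intro mult_left_mono) (auto simp: near_def Box_def simp del: of_nat_mult)
  finally have "x \<ge> real (C * s * L)" by (simp add: abs_le_iff algebra_simps)
  moreover have "C * s * L > 0" using C_pos assms by (simp add: s_def)
  hence "real (C * s * L) > 0" by (simp only: of_nat_0_less_iff)
  ultimately show ?thesis by linarith
qed

lemma finite_near: "finite (near L)" and card_near: "card (near L) = (2 * s * L + 1) ^ d"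
proof -
  have eq: "near L = (\<lambda>x. x + of_nat (2 * C * s * L)) ` Box (s * L)"
  proof (intro equalityI subsetI)
    fix x assume "x \<in> near L"
    thus "x \<in> (\<lambda>x. x + of_nat (2 * C * s * L)) ` Box (s * L)"
      by (intro image_eqI[of _ _ "x - of_nat (2 * C * s * L)"]) (simp_all add: near_def)
  qed (auto simp: near_def)
  show "finite (near L)" unfolding eq by simp
  show "card (near L) = (2 * s * L + 1) ^ d"
    unfolding eq by (subst card_image) (auto simp: card_Box inj_on_def mult.assoc)
qed

text \<open>Write \<open>m = h + \<nu>\<close> with \<open>h = 2 * C * s * L\<close>. Multiplication
  by the natural number \<open>h\<close> scales \<open>nm\<close> exactly, while the term with
  \<open>\<nu>\<close> costs at most half of that and can be absorbed on the left.\<close>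

lemma nm_ratio_le:
  assumes l: "l \<in> near L" and m: "m \<in> near L" and L: "L \<ge> 1"
    and R: "l' \<in> R" "m' \<in> R" and eq: "l' * m = l * m'"
  shows "nm l' \<le> 3 * C * nm m'"
proof -
  let ?h = "of_nat (2 * C * s * L) :: real"
  have \<nu>: "m - ?h \<in> Box (s * L)" using m by (simp add: near_def)
  have "?h * l' = l * m' - (m - ?h) * l'" using eq by (simp add: algebra_simps)
  hence "nm (?h * l') \<le> nm (l * m') + nm ((m - ?h) * l')"
    using nm_diff[of "l * m'" "(m - ?h) * l'"] near_mem[OF l] \<nu> R
    by (auto simp: Box_def intro: mult_mem simp del: of_nat_mult)
  also have "nm (l * m') \<le> C * nm l * nm m'" by (intro nm_mult near_mem[OF l] R)
  also have "\<dots> \<le> C * (3 * C * s * L) * nm m'"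
    using nm_near[OF l] by (intro mult_mono) auto
  also have "nm ((m - ?h) * l') \<le> C * nm (m - ?h) * nm l'"
    using \<nu> R by (intro nm_mult) (auto simp: Box_def)
  also have "\<dots> \<le> C * (s * L) * nm l'"
    using \<nu> by (intro mult_mono) (auto simp: Box_def)
  also have "nm (?h * l') = 2 * C * s * L * nm l'" by (rule nm_of_nat_mult[OF R(1)])
  finally have "(C * s * L) * nm l' \<le> (C * s * L) * (3 * C * nm m')"
    by (simp add: algebra_simps)
  moreover have "C * s * L > 0" using C_pos L by (simp add: s_def)
  ultimately show ?thesis by (subst (asm) mult_le_cancel1) simp
qed

section \<open>New ratios at one scale\<close>

definition ratios :: "nat \<Rightarrow> real set" where
  "ratios L = (\<lambda>(l, m). l / m) ` (near L \<times> near L)"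

text \<open>Newness is tested on denominators: a representation at a much smaller scale would supply
  a nonzero one of size at most \<open>2 * L\<close>. The radius matches
  \<open>card_le_ring_part\<close>, so a new ratio has at most \<open>(s + 1) ^ d\<close>
  representations.\<close>

definition new_ratios :: "nat \<Rightarrow> real set" where
  "new_ratios L = {t \<in> ratios L. ring_part t \<inter> Box (2 * L) = {0}}"

lemma finite_ratios: "finite (ratios L)"
  by (simp add: ratios_def finite_near)

lemma zero_in_ring_part [simp]: "0 \<in> ring_part t"
  by (simp add: ring_part_def zero_mem)

text \<open>The pairs are sorted by their ratio. New ratios have bounded fibres; the fibre of an old
  ratio is charged to its small nonzero denominators, whose total number is bounded by boxes that do
  not grow with \<open>s\<close>.\<close>

lemma card_near_pairs_le:
  assumes L: "L \<ge> 1"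
  shows "(2 * s * L + 1) ^ (2 * d) \<le> (s + 1) ^ d * card (new_ratios L)
    + 2 * (s + 1) ^ d * ((12 * C * L + 1) ^ d * (4 * L + 1) ^ d)"
proof -
  define fib where "fib t = {p \<in> near L \<times> near L. fst p / snd p = t}" for t
  define bad where "bad = ratios L - new_ratios L"
  have fin: "finite bad" "finite (new_ratios L)" by (auto simp: bad_def new_ratios_def finite_ratios)
  have fib_le: "card (fib t) \<le> (s + 1) ^ d * card (ring_part t \<inter> Box (2 * L))" for t
  proof -
    have l: "l = t * m" if "(l, m) \<in> fib t" for l m
      using that near_pos[of m L] L by (auto simp: fib_def)
    have "card (fib t) = card (snd ` fib t)"
    proof (rule card_image[symmetric], rule inj_onI)
      fix p q assume "p \<in> fib t" "q \<in> fib t" "snd p = snd q"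
      thus "p = q" using l[of "fst p" "snd p"] l[of "fst q" "snd q"]
        by (metis prod.collapse)
    qed
    also have "\<dots> \<le> (s + 1) ^ d * card (ring_part t \<inter> Box (2 * L))"
    proof (rule card_le_ring_part)
      show "snd ` fib t \<subseteq> ring_part t"
      proof (rule image_subsetI)
        fix p assume p: "p \<in> fib t"
        hence "fst p \<in> R" "snd p \<in> R" by (auto simp: fib_def intro: near_mem)
        thus "snd p \<in> ring_part t" using p l[of "fst p" "snd p"] by (simp add: ring_part_def)
      qed
      show "x - of_nat (2 * C * s * L) \<in> Box (s * L)" if "x \<in> snd ` fib t" for x
        using that by (auto simp: fib_def near_def)
    qed
    finally show ?thesis .
  qed
  have new: "card (fib t) \<le> (s + 1) ^ d" if "t \<in> new_ratios L" for t
    using fib_le[of t] that by (simp add: new_ratios_def)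
  let ?B = "\<lambda>t. ring_part t \<inter> Box (2 * L) - {0}"
  have old: "card (fib t) \<le> 2 * (s + 1) ^ d * card (?B t)" if "t \<in> bad" for t
  proof -
    have "?B t \<noteq> {}" using that by (auto simp: bad_def new_ratios_def)
    hence "card (?B t) \<ge> 1" using card_gt_0_iff[of "?B t"] finite_Box[of "2 * L"]
      by (simp only: finite_Diff finite_Int less_eq_Suc_le One_nat_def simp_thms)
    moreover have "card (ring_part t \<inter> Box (2 * L)) = card (?B t) + 1"
      using card.remove[of "ring_part t \<inter> Box (2 * L)" 0]
      by (simp only: finite_Int finite_Box IntI zero_in_ring_part zero_in_Box simp_thms Suc_eq_plus1)
    \<comment> \<open>An old ratio has at least one nonzero small denominator, so a factor 2
      accounts for the element 0.\<close>
    ultimately have "card (ring_part t \<inter> Box (2 * L)) \<le> 2 * card (?B t)" by linarith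
    hence "(s + 1) ^ d * card (ring_part t \<inter> Box (2 * L)) \<le> (s + 1) ^ d * (2 * card (?B t))"
      by (rule mult_left_mono) simp
    with fib_le[of t] show ?thesis by (simp only: mult_ac)
  qed
  \<comment> \<open>Since \<open>x\<close> is nonzero, the pair \<open>(t * x, x)\<close> determines
    \<open>t\<close>. By \<open>nm_ratio_le\<close> the numerator has size at most
    \<open>3 * C * (2 * L)\<close>.\<close>
  have "card (SIGMA t:bad. ?B t) \<le> card (Box (6 * C * L) \<times> Box (2 * L))"
  proof (rule card_inj_on_le)
    show "inj_on (\<lambda>(t, x). (t * x, x)) (SIGMA t:bad. ?B t)"
      by (auto intro!: inj_onI)
    show "(\<lambda>(t, x). (t * x, x)) ` (SIGMA t:bad. ?B t) \<subseteq> Box (6 * C * L) \<times> Box (2 * L)"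
    proof (rule image_subsetI)
      fix p assume "p \<in> (SIGMA t:bad. ?B t)"
      then obtain t x where p: "p = (t, x)" and t: "t \<in> bad"
        and x: "x \<in> ring_part t" "x \<in> Box (2 * L)" by auto
      obtain l m where lm: "l \<in> near L" "m \<in> near L" "t = l / m"
        using t by (auto simp: bad_def ratios_def)
      have "nm (t * x) \<le> 3 * C * nm x"
        using lm near_pos[OF lm(2) L] x
        by (intro nm_ratio_le[OF lm(1,2) L]) (auto simp: ring_part_def)
      also have "\<dots> \<le> 3 * C * (2 * L)" using x by (intro mult_left_mono) (auto simp: Box_def)
      finally show "(case p of (t, x) \<Rightarrow> (t * x, x)) \<in> Box (6 * C * L) \<times> Box (2 * L)"
        using x by (auto simp: p Box_def ring_part_def)
    qed
  qed simp
  also have "\<dots> = (12 * C * L + 1) ^ d * (4 * L + 1) ^ d"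
    by (simp add: card_cartesian_product card_Box mult.assoc)
  also have "card (SIGMA t:bad. ?B t) = (\<Sum>t\<in>bad. card (?B t))"
    using fin by (intro card_SigmaI) auto
  finally have sum_bad: "(\<Sum>t\<in>bad. card (?B t)) \<le> (12 * C * L + 1) ^ d * (4 * L + 1) ^ d" .
  have "(2 * s * L + 1) ^ (2 * d) = card (near L \<times> near L)"
    by (simp add: card_cartesian_product card_near mult_2 power_add)
  also have "near L \<times> near L = (\<Union>t\<in>ratios L. fib t)"
    by (force simp: fib_def ratios_def)
  also have "card (\<Union>t\<in>ratios L. fib t) \<le> (\<Sum>t\<in>ratios L. card (fib t))"
    by (rule card_UN_le[OF finite_ratios])
  also have "ratios L = new_ratios L \<union> bad"
    by (auto simp: bad_def new_ratios_def)
  also have "(\<Sum>t\<in>new_ratios L \<union> bad. card (fib t))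
      = (\<Sum>t\<in>new_ratios L. card (fib t)) + (\<Sum>t\<in>bad. card (fib t))"
    using fin by (intro sum.union_disjoint) (auto simp: bad_def)
  also have "(\<Sum>t\<in>new_ratios L. card (fib t)) \<le> (\<Sum>t\<in>new_ratios L. (s + 1) ^ d)"
    by (intro sum_mono new)
  also have "(\<Sum>t\<in>bad. card (fib t)) \<le> (\<Sum>t\<in>bad. 2 * (s + 1) ^ d * card (?B t))"
    by (intro sum_mono old)
  also have "\<dots> = 2 * (s + 1) ^ d * (\<Sum>t\<in>bad. card (?B t))"
    by (simp only: sum_distrib_left)
  also have "\<dots> \<le> 2 * (s + 1) ^ d * ((12 * C * L + 1) ^ d * (4 * L + 1) ^ d)"
    by (rule mult_left_mono[OF sum_bad]) simp
  finally show ?thesis by (simp add: mult.commute)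
qed

text \<open>With \<open>Q = (s * L) ^ (2 * d)\<close> there are at least \<open>4 * Q\<close> pairs,
  of which at most \<open>2 * Q\<close> have an old ratio. The remaining pairs are spread over
  fibres of size at most \<open>(s + 1) ^ d\<close>.\<close>

lemma card_new_ratios:
  assumes L: "L \<ge> 1"
  shows "card (new_ratios L) \<ge> L ^ (2 * d)"
proof -
  let ?Q = "(s * L) ^ (2 * d)"
  have CL: "C * L \<ge> 1" using C_pos L by simp
  have s1: "s \<ge> 1" using C_pos by (simp add: s_def)
  have "(s + 1) ^ d * ((12 * C * L + 1) ^ d * (4 * L + 1) ^ d)
      = ((s + 1) * ((12 * C * L + 1) * (4 * L + 1))) ^ d"
    by (simp only: power_mult_distrib)
  \<comment> \<open>The rounded factors have product \<open>130 * C * s * L\<^sup>2\<close>, which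
    is \<open>(s * L)\<^sup>2\<close> precisely because \<open>s = 130 * C\<close>.\<close>
  also have "\<dots> \<le> ((2 * s) * ((13 * (C * L)) * (5 * L))) ^ d"
    using CL L s1 by (intro power_mono mult_mono) auto
  also have "(2 * s) * ((13 * (C * L)) * (5 * L)) = (s * L) ^ 2"
    by (simp add: s_def power2_eq_square)
  also have "((s * L)\<^sup>2) ^ d = ?Q" by (simp only: power_mult)
  finally have bad: "(s + 1) ^ d * ((12 * C * L + 1) ^ d * (4 * L + 1) ^ d) \<le> ?Q" .
  have "4 * ?Q \<le> 4 ^ d * ?Q" using d_pos by (intro mult_right_mono self_le_power) auto
  also have "(4::nat) ^ d = 2 ^ (2 * d)" by (simp add: power_mult)
  also have "2 ^ (2 * d) * ?Q = (2 * s * L) ^ (2 * d)"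
    by (simp only: power_mult_distrib mult.assoc)
  also have "\<dots> \<le> (2 * s * L + 1) ^ (2 * d)" by (rule power_mono) auto
  also have "\<dots> \<le> (s + 1) ^ d * card (new_ratios L) + 2 * ?Q"
    using card_near_pairs_le[OF L] bad by linarith
  finally have 1: "?Q \<le> (s + 1) ^ d * card (new_ratios L)" by linarith
  \<comment> \<open>This absorbs the fibre size: \<open>(s + 1) ^ d * L ^ (2 * d)\<close> is at most
    \<open>Q\<close>, which leaves the clean bound \<open>L ^ (2 * d)\<close>.\<close>
  have "s + 1 \<le> s\<^sup>2"
  proof -
    have "1 \<le> C * C" "C \<le> C * C" using C_pos by auto
    hence "130 * C + 1 \<le> 16900 * (C * C)" by linarith
    thus ?thesis by (simp add: s_def power2_eq_square)
  qed
  hence "(s + 1) ^ d * L ^ (2 * d) \<le> (s\<^sup>2) ^ d * L ^ (2 * d)"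
    by (intro mult_right_mono power_mono) auto
  also have "\<dots> = ?Q" by (simp only: power_mult_distrib power_mult)
  finally have "(s + 1) ^ d * L ^ (2 * d) \<le> (s + 1) ^ d * card (new_ratios L)"
    using 1 by linarith
  thus ?thesis by (subst (asm) mult_le_cancel1) simp
qed

text \<open>A ratio at scale \<open>L\<close> has a denominator in \<open>near L\<close>, nonzero
  and of size at most \<open>3 * C * s * L\<close>. If this is at most \<open>2 * L'\<close>, the
  ratio is not new at scale \<open>L'\<close>.\<close>

lemma new_ratios_disjoint:
  assumes "L \<ge> 1" "3 * C * s * L \<le> 2 * L'"
  shows "new_ratios L \<inter> new_ratios L' = {}"
proof (rule ccontr)
  assume "new_ratios L \<inter> new_ratios L' \<noteq> {}"
  then obtain t where t: "t \<in> ratios L" "ring_part t \<inter> Box (2 * L') = {0}"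
    by (auto simp: new_ratios_def)
  then obtain l m where lm: "l \<in> near L" "m \<in> near L" "t = l / m"
    by (auto simp: ratios_def)
  have "m > 0" by (rule near_pos[OF lm(2) assms(1)])
  hence "m \<in> ring_part t" using lm near_mem by (auto simp: ring_part_def)
  moreover have "m \<in> Box (2 * L')" using nm_near[OF lm(2)] near_mem[OF lm(2)] assms by (auto simp: Box_def)
  ultimately have "m \<in> {0}" using t(2) by blast
  with \<open>m > 0\<close> show False by simp
qed

end

section \<open>Orders with a power basis\<close>

text \<open>Independence over \<open>\<int>\<close> makes coefficients unique; the monic relation
  for \<open>b ^ d\<close> makes the span of \<open>1, b, ..., b ^ (d - 1)\<close> closed under
  multiplication.\<close>

locale power_basis =
  fixes b :: real and d :: nat
  assumes d_pos: "d \<ge> 1"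
    and indep: "(\<Sum>i<d. of_int (c i) * b ^ i) = 0 \<Longrightarrow> i < d \<Longrightarrow> c i = (0 :: int)"
    and reduction: "\<exists>c :: nat \<Rightarrow> int. b ^ d = (\<Sum>i<d. of_int (c i) * b ^ i)"
begin

definition comb :: "(nat \<Rightarrow> int) \<Rightarrow> real" where
  "comb c = (\<Sum>i<d. of_int (c i) * b ^ i)"

definition span_le :: "nat \<Rightarrow> real set" where
  "span_le N = comb ` {c. \<forall>i<d. \<bar>c i\<bar> \<le> int N}"

definition R :: "real set" where "R = range comb"

text \<open>The largest coefficient in absolute value, encoded as a least box size so that no
  coordinate functions have to be chosen.\<close>

definition nm :: "real \<Rightarrow> nat" where "nm x = (LEAST N. x \<in> span_le N)"

lemma comb_add: "comb c + comb c' = comb (\<lambda>i. c i + c' i)"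
  by (simp add: comb_def sum.distrib algebra_simps)

lemma comb_scale: "of_int k * comb c = comb (\<lambda>i. k * c i)"
  by (simp add: comb_def sum_distrib_left algebra_simps)

lemma comb_eq_iff: "comb c = comb c' \<longleftrightarrow> (\<forall>i<d. c i = c' i)"
proof
  assume eq: "comb c = comb c'"
  have "(\<Sum>i<d. of_int (c i - c' i) * b ^ i) = comb c - comb c'"
    by (simp add: comb_def sum_subtractf algebra_simps)
  thus "\<forall>i<d. c i = c' i" using indep[of "\<lambda>i. c i - c' i"] eq by auto
qed (simp add: comb_def)

lemma span_le_mono: "M \<le> N \<Longrightarrow> span_le M \<subseteq> span_le N"
  by (force simp: span_le_def)

lemma comb_in_span_le: "comb c \<in> span_le N \<longleftrightarrow> (\<forall>i<d. \<bar>c i\<bar> \<le> int N)"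
proof
  assume "comb c \<in> span_le N"
  then obtain c' where "comb c = comb c'" "\<forall>i<d. \<bar>c' i\<bar> \<le> int N" by (auto simp: span_le_def)
  thus "\<forall>i<d. \<bar>c i\<bar> \<le> int N" by (simp add: comb_eq_iff)
qed (auto simp: span_le_def)

lemma R_in_span_le: "x \<in> R \<Longrightarrow> \<exists>N. x \<in> span_le N"
proof -
  assume "x \<in> R"
  then obtain c where x: "x = comb c" by (auto simp: R_def)
  have "\<bar>c i\<bar> \<le> int (nat (\<Sum>i<d. \<bar>c i\<bar>))" if "i < d" for i
    using that member_le_sum[of i "{..<d}" "\<lambda>i. \<bar>c i\<bar>"] by (simp add: sum_nonneg)
  thus ?thesis unfolding x using comb_in_span_le by blast
qed

lemma nm_le_iff: "x \<in> R \<Longrightarrow> nm x \<le> N \<longleftrightarrow> x \<in> span_le N"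
  unfolding nm_def using LeastI_ex[OF R_in_span_le] span_le_mono Least_le
  by (metis (mono_tags, lifting) subsetD)

lemma comb_mem [simp]: "comb c \<in> R"
  by (simp add: R_def)

lemma nm_comb_le_iff: "nm (comb c) \<le> N \<longleftrightarrow> (\<forall>i<d. \<bar>c i\<bar> \<le> int N)"
  by (simp add: nm_le_iff comb_in_span_le)

lemma coeff_le_nm: "i < d \<Longrightarrow> \<bar>c i\<bar> \<le> int (nm (comb c))"
  using nm_comb_le_iff by blast

lemma R_E: "x \<in> R \<Longrightarrow> (\<And>c. x = comb c \<Longrightarrow> P) \<Longrightarrow> P"
  by (auto simp: R_def)

lemma add_mem: "x \<in> R \<Longrightarrow> y \<in> R \<Longrightarrow> x + y \<in> R"
  by (auto elim!: R_E simp: comb_add)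

lemma scale_mem: "x \<in> R \<Longrightarrow> of_int k * x \<in> R"
  by (auto elim!: R_E simp: comb_scale)

lemma zero_mem: "0 \<in> R"
proof -
  have "comb (\<lambda>_. 0) = 0" by (simp add: comb_def)
  thus ?thesis by (metis comb_mem)
qed

lemma sum_mem: "(\<And>i. i \<in> A \<Longrightarrow> f i \<in> R) \<Longrightarrow> sum f A \<in> R"
  by (induction A rule: infinite_finite_induct) (auto intro: add_mem zero_mem)

lemma nm_zero: "nm 0 = 0"
proof -
  have "comb (\<lambda>_. 0) = 0" by (simp add: comb_def)
  thus ?thesis using nm_comb_le_iff[of "\<lambda>_. 0" 0] by simp
qed

lemma nm_add: "x \<in> R \<Longrightarrow> y \<in> R \<Longrightarrow> nm (x + y) \<le> nm x + nm y"
proof (elim R_E)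
  fix c c' assume x: "x = comb c" "y = comb c'"
  have "\<bar>c i + c' i\<bar> \<le> int (nm (comb c) + nm (comb c'))" if "i < d" for i
    using coeff_le_nm[OF that, of c] coeff_le_nm[OF that, of c'] by linarith
  thus ?thesis by (simp add: x comb_add nm_comb_le_iff)
qed

text \<open>Equality matters: the lower bound is what lets \<open>nm_ratio_le\<close> isolate its
  main term.\<close>

lemma nm_scale: "x \<in> R \<Longrightarrow> nm (of_int k * x) = nat \<bar>k\<bar> * nm x"
proof (elim R_E)
  fix c assume x: "x = comb c"
  have "\<bar>k * c i\<bar> \<le> int (nat \<bar>k\<bar> * nm (comb c))" if "i < d" for i
    using coeff_le_nm[OF that, of c] by (simp add: abs_mult mult_left_mono)
  hence 1: "nm (comb (\<lambda>i. k * c i)) \<le> nat \<bar>k\<bar> * nm (comb c)" by (simp add: nm_comb_le_iff)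
  have "nat \<bar>k\<bar> * nm (comb c) \<le> nm (comb (\<lambda>i. k * c i))"
  proof (cases "k = 0")
    case False
    \<comment> \<open>Dividing the bound on \<open>k * c i\<close> by the absolute value of
      \<open>k\<close> bounds \<open>c i\<close>; rounding down is harmless because coefficients are
      integers.\<close>
    let ?M = "nm (comb (\<lambda>i. k * c i))"
    have "\<bar>c i\<bar> \<le> int (?M div nat \<bar>k\<bar>)" if "i < d" for i
    proof -
      have "nat \<bar>k * c i\<bar> \<le> ?M"
        using coeff_le_nm[OF that, of "\<lambda>i. k * c i"] by (simp only: nat_le_iff)
      hence "nat \<bar>c i\<bar> * nat \<bar>k\<bar> \<le> ?M" 
        by (simp only: nat_abs_mult_distrib mult.commute)
      hence "nat \<bar>c i\<bar> \<le> ?M div nat \<bar>k\<bar>" using False by (simp add: less_eq_div_iff_mult_less_eq)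
      thus ?thesis by (simp only: nat_le_iff)
    qed
    hence "nm (comb c) \<le> ?M div nat \<bar>k\<bar>" unfolding nm_comb_le_iff by blast
    thus ?thesis using False by (simp add: less_eq_div_iff_mult_less_eq mult.commute)
  qed simp
  with 1 show ?thesis by (simp add: x comb_scale)
qed

lemma nm_sum: "(\<And>i. i \<in> A \<Longrightarrow> f i \<in> R) \<Longrightarrow> nm (sum f A) \<le> (\<Sum>i\<in>A. nm (f i))"
proof (induction A rule: infinite_finite_induct)
  case (insert x A)
  thus ?case using nm_add[of "f x" "sum f A"] sum_mem[of A f] by fastforce
qed (auto simp: nm_zero)

text \<open>For \<open>k \<ge> d\<close>, replacing one factor \<open>b ^ d\<close> by its relation
  leaves only exponents below \<open>k\<close>.\<close>

lemma power_mem: "b ^ k \<in> R"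
proof (induction k rule: less_induct)
  case (less k)
  show ?case
  proof (cases "k < d")
    case True
    have "comb (\<lambda>i. if i = k then 1 else 0) = (\<Sum>i<d. if i = k then b ^ i else 0)"
      unfolding comb_def by (rule sum.cong) auto
    also have "\<dots> = b ^ k" using True by simp
    finally show ?thesis by (metis comb_mem)
  next
    case False
    obtain c :: "nat \<Rightarrow> int" where c: "b ^ d = (\<Sum>i<d. of_int (c i) * b ^ i)" using reduction by blast
    have "b ^ k = b ^ (k - d) * b ^ d" using False by (simp flip: power_add)
    also have "\<dots> = (\<Sum>i<d. of_int (c i) * b ^ (k - d + i))"
      by (simp add: c sum_distrib_left power_add mult_ac)
    also have "\<dots> \<in> R" using False by (intro sum_mem scale_mem less.IH) auto
    finally show ?thesis .
  qed
qed

lemma comb_mult: "comb c * comb c' = (\<Sum>i<d. \<Sum>j<d. of_int (c i * c' j) * b ^ (i + j))"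
  by (simp add: comb_def sum_product power_add mult_ac)

text \<open>The summands serve \<open>C \<ge> 1\<close>, the bound for products (sizes of the powers
  \<open>b ^ (i + j)\<close>) and the bound for absolute values, in this order.\<close>

definition C :: nat where
  "C = 1 + (\<Sum>i<d. \<Sum>j<d. nm (b ^ (i + j))) + nat \<lceil>\<Sum>i<d. \<bar>b ^ i\<bar>\<rceil>"

lemma mult_mem: "x \<in> R \<Longrightarrow> y \<in> R \<Longrightarrow> x * y \<in> R"
  by (auto elim!: R_E simp: comb_mult simp del: of_int_mult intro!: sum_mem scale_mem power_mem)

lemma nm_mult: "x \<in> R \<Longrightarrow> y \<in> R \<Longrightarrow> nm (x * y) \<le> C * nm x * nm y"
proof (elim R_E)
  fix c c' assume x: "x = comb c" "y = comb c'"
  have "nm (x * y) \<le> (\<Sum>i<d. nm (\<Sum>j<d. of_int (c i * c' j) * b ^ (i + j)))"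
    unfolding x comb_mult by (intro nm_sum sum_mem scale_mem power_mem)
  also have "\<dots> \<le> (\<Sum>i<d. \<Sum>j<d. nm (of_int (c i * c' j) * b ^ (i + j)))"
    by (intro sum_mono nm_sum scale_mem power_mem)
  also have "\<dots> \<le> (\<Sum>i<d. \<Sum>j<d. (nm x * nm y) * nm (b ^ (i + j)))"
  proof (intro sum_mono)
    fix i j assume ij: "i \<in> {..<d}" "j \<in> {..<d}"
    have "\<bar>c i * c' j\<bar> \<le> int (nm x) * int (nm y)"
      using ij coeff_le_nm[of i c] coeff_le_nm[of j c'] by (simp add: x abs_mult mult_mono)
    hence "nat \<bar>c i * c' j\<bar> \<le> nm x * nm y" by (simp add: nat_le_iff)
    thus "nm (of_int (c i * c' j) * b ^ (i + j)) \<le> nm x * nm y * nm (b ^ (i + j))"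
      by (subst nm_scale[OF power_mem]) (rule mult_right_mono, auto)
  qed
  also have "\<dots> = (nm x * nm y) * (\<Sum>i<d. \<Sum>j<d. nm (b ^ (i + j)))"
    by (simp only: sum_distrib_left)
  also have "\<dots> \<le> (nm x * nm y) * C" by (intro mult_left_mono) (auto simp: C_def)
  finally show ?thesis by (simp only: mult_ac)
qed

lemma abs_le_nm: "x \<in> R \<Longrightarrow> \<bar>x\<bar> \<le> real C * real (nm x)"
proof (elim R_E)
  fix c assume x: "x = comb c"
  have "\<bar>x\<bar> \<le> (\<Sum>i<d. \<bar>of_int (c i) * b ^ i\<bar>)" unfolding x comb_def by (rule sum_abs)
  also have "\<dots> \<le> (\<Sum>i<d. real (nm x) * \<bar>b ^ i\<bar>)"
  proof (intro sum_mono)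
    fix i assume "i \<in> {..<d}"
    hence "real_of_int \<bar>c i\<bar> \<le> real_of_int (int (nm x))"
      unfolding x using coeff_le_nm by (intro of_int_le_iff[THEN iffD2]) auto
    thus "\<bar>of_int (c i) * b ^ i\<bar> \<le> real (nm x) * \<bar>b ^ i\<bar>"
      unfolding abs_mult by (intro mult_right_mono) auto
  qed
  also have "\<dots> = (\<Sum>i<d. \<bar>b ^ i\<bar>) * real (nm x)" by (simp add: sum_distrib_left mult.commute)
  also have "(\<Sum>i<d. \<bar>b ^ i\<bar>) \<le> real C"
    using real_nat_ceiling_ge[of "\<Sum>i<d. \<bar>b ^ i\<bar>"] unfolding C_def by linarith
  finally show ?thesis by (simp add: mult_right_mono)
qed

lemma card_nm_le: "card {x \<in> R. nm x \<le> N} = (2 * N + 1) ^ d"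
proof -
  \<comment> \<open>\<open>comb\<close> ignores arguments from \<open>d\<close> on, so coefficient
    functions are taken extensional to make \<open>comb\<close> injective.\<close>
  let ?P = "PiE {..<d} (\<lambda>_. {- int N..int N})"
  have "{x \<in> R. nm x \<le> N} = comb ` ?P"
  proof (intro equalityI subsetI)
    fix x assume "x \<in> {x \<in> R. nm x \<le> N}"
    then obtain c where c: "x = comb c" "\<forall>i<d. \<bar>c i\<bar> \<le> int N"
      by (auto elim!: R_E simp: nm_comb_le_iff)
    have "x = comb (restrict c {..<d})" unfolding c(1) by (simp add: comb_eq_iff)
    moreover have "restrict c {..<d} \<in> ?P" using c(2) by (auto simp: abs_le_iff)
    ultimately show "x \<in> comb ` ?P" by blast
  next
    fix x assume "x \<in> comb ` ?P"
    then obtain c where c: "x = comb c" "c \<in> ?P" by blast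
    hence "\<forall>i<d. \<bar>c i\<bar> \<le> int N" by (force simp: PiE_iff abs_le_iff)
    thus "x \<in> {x \<in> R. nm x \<le> N}" by (simp add: c(1) nm_comb_le_iff)
  qed
  moreover have "inj_on comb ?P"
    by (rule inj_onI, rule PiE_ext) (auto simp: comb_eq_iff)
  moreover have "nat (2 * int N + 1) = 2 * N + 1" by simp
  ultimately show ?thesis by (simp add: card_image card_PiE del: Suc_eq_plus1)
qed

sublocale normed_order R nm d C
proof
  show "1 \<in> R" using power_mem[of 0] by simp
  have "comb (\<lambda>i. if i = 0 then 1 else 0) = (\<Sum>i<d. if i = 0 then b ^ i else 0)"
    unfolding comb_def by (rule sum.cong) auto
  also have "\<dots> = 1" using d_pos by simp
  finally show "nm 1 \<le> 1" using nm_comb_le_iff[of "\<lambda>i. if i = 0 then 1 else 0" 1] by simp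
  show "- x \<in> R" "nm (- x) = nm x" if "x \<in> R" for x
    using scale_mem[OF that, of "-1"] nm_scale[OF that, of "-1"] by simp_all
  show "nm (of_nat k * x) = k * nm x" if "x \<in> R" for k x
    using nm_scale[OF that, of "int k"] by simp
  show "C \<ge> 1" by (simp add: C_def)
  show "d \<ge> 1" by (rule d_pos)
  show "card {x \<in> R. nm x \<le> N} = (2 * N + 1) ^ d" for N by (rule card_nm_le)
qed (auto intro: add_mem mult_mem nm_add nm_mult abs_le_nm)

end

section \<open>From an algebraic number to a power basis\<close>

text \<open>For a nonzero integer polynomial of least degree with root \<open>a\<close> and leading
  coefficient \<open>m\<close>, the number \<open>m * a\<close> is an algebraic integer, and
  minimality of the degree gives independence of its powers.\<close>

lemma algebraic_imp_normed_order:
  assumes "algebraic (a :: real)"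
  obtains R nm d C and m :: nat
  where "normed_order R nm d C" "m \<ge> 1" "of_nat m * a \<in> R"
proof -
  define Z where "Z p \<longleftrightarrow> p \<noteq> 0 \<and> poly (map_poly of_int p) a = 0" for p :: "int poly"
  obtain p0 where "Z p0" using algebraicE'[OF assms] unfolding Z_def by metis
  define p where "p = arg_min degree Z"
  have min: "degree p \<le> degree q" if "Z q" for q
    unfolding p_def using arg_min_nat_le[of Z q degree] that by simp
  have p: "p \<noteq> 0" "poly (map_poly of_int p) a = 0"
    using arg_min_natI[of Z, OF \<open>Z p0\<close>] by (auto simp: Z_def p_def)
  define m where "m = lead_coeff p"
  define d where "d = degree p"
  define b where "b = of_int m * a"
  have m: "m \<noteq> 0" using p by (simp add: m_def)
  have root: "(\<Sum>i\<le>d. of_int (coeff p i) * a ^ i) = 0"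
    using p(2) by (simp add: poly_altdef d_def degree_map_poly coeff_map_poly)
  interpret power_basis b d
  proof
    show d: "d \<ge> 1"
    proof (rule ccontr)
      assume "\<not> d \<ge> 1"
      hence "d = 0" by simp
      with root have "m = 0" by (simp add: m_def d_def del: leading_coeff_0_iff)
      with m show False ..
    qed
    show "c i = 0" if eq: "(\<Sum>i<d. of_int (c i) * b ^ i) = 0" and i: "i < d" for c :: "nat \<Rightarrow> int" and i
    proof (rule ccontr)
      assume "c i \<noteq> 0"
      \<comment> \<open>Evaluated at \<open>a\<close>, this polynomial is the given combination of
        powers of \<open>b = m * a\<close>; its degree is too small for a nonzero polynomial with
        root \<open>a\<close>.\<close>
      define q where "q = (\<Sum>j<d. monom (c j * m ^ j) j)"
      have cq: "coeff q j = (if j < d then c j * m ^ j else 0)" for j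
        by (simp add: q_def coeff_sum)
      have "q \<noteq> 0" using cq[of i] \<open>c i \<noteq> 0\<close> i m by auto
      have deg: "degree q < d" using cq d by (intro degree_lessI) auto
      have "poly (map_poly of_int q) a = (\<Sum>j\<le>degree q. of_int (coeff q j) * a ^ j)"
        by (simp add: poly_altdef degree_map_poly coeff_map_poly)
      also have "\<dots> = (\<Sum>j<d. of_int (coeff q j) * a ^ j)"
        by (rule sum.mono_neutral_left) (use deg in \<open>auto simp: coeff_eq_0\<close>)
      also have "\<dots> = (\<Sum>i<d. of_int (c i) * b ^ i)"
        by (intro sum.cong) (auto simp: cq b_def power_mult_distrib)
      finally have "Z q" using eq \<open>q \<noteq> 0\<close> by (simp add: Z_def)
      from min[OF this] deg show False by (simp add: d_def)
    qed
    show "\<exists>c :: nat \<Rightarrow> int. b ^ d = (\<Sum>i<d. of_int (c i) * b ^ i)"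
    proof (intro exI[of _ "\<lambda>i. - coeff p i * m ^ (d - 1 - i)"])
      \<comment> \<open>Multiplying by \<open>m ^ (d - 1)\<close> turns the leading term into
        \<open>b ^ d\<close> and keeps the other coefficients integral in powers of
        \<open>b\<close>.\<close>
      have "0 = of_int m ^ (d - 1) * (\<Sum>i\<le>d. of_int (coeff p i) * a ^ i)" using root by simp
      also have "\<dots> = of_int m ^ (d - 1) * (\<Sum>i<d. of_int (coeff p i) * a ^ i)
          + of_int m ^ (d - 1) * (of_int m * a ^ d)"
        unfolding lessThan_Suc_atMost[symmetric] sum.lessThan_Suc distrib_left
        by (simp only: m_def d_def)
      also have "of_int m ^ (d - 1) * (of_int m * a ^ d) = b ^ d"
        using d power_Suc[of "of_int m :: real" "d - 1"] by (simp add: b_def power_mult_distrib)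
      also have "of_int m ^ (d - 1) * (\<Sum>i<d. of_int (coeff p i) * a ^ i)
          = (\<Sum>i<d. of_int (coeff p i * m ^ (d - 1 - i)) * b ^ i)"
        unfolding sum_distrib_left
      proof (intro sum.cong refl)
        fix i assume "i \<in> {..<d}"
        hence "real_of_int m ^ (d - 1) = of_int m ^ (d - 1 - i) * of_int m ^ i"
          by (simp flip: power_add)
        thus "of_int m ^ (d - 1) * (of_int (coeff p i) * a ^ i)
            = of_int (coeff p i * m ^ (d - 1 - i)) * b ^ i"
          by (simp add: b_def power_mult_distrib)
      qed
      finally show "b ^ d = (\<Sum>i<d. of_int (- coeff p i * m ^ (d - 1 - i)) * b ^ i)"
        by (simp add: sum_negf)
    qed
  qed
  \<comment> \<open>The leading coefficient may be negative, while the conclusion asks for a natural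
    multiplier.\<close>
  have "of_nat (nat \<bar>m\<bar>) * a = b \<or> of_nat (nat \<bar>m\<bar>) * a = - b"
    by (auto simp: b_def abs_if)
  moreover have "b \<in> R" using power_mem[of 1] by simp
  ultimately have "of_nat (nat \<bar>m\<bar>) * a \<in> R" using minus_mem by metis
  with m normed_order_axioms show ?thesis by (intro that[of R nm d C "nat \<bar>m\<bar>"]) auto
qed

section \<open>Triples in the plane\<close>

text \<open>Coordinates are kept as pairs, so that point sets are products of boxes.\<close>

definition pt :: "real \<times> real \<Rightarrow> real^2" where
  "pt w = vector [fst w, snd w]"

lemma pt_add: "pt w + pt w' = pt (w + w')"
  by (simp add: pt_def vec_eq_iff forall_2)

lemma pt_eq_iff [simp]: "pt w = pt w' \<longleftrightarrow> w = w'"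
  by (simp add: pt_def vec_eq_iff forall_2 prod_eq_iff)

lemma pt_eq_0_iff [simp]: "pt w = 0 \<longleftrightarrow> w = 0"
  by (simp add: pt_def vec_eq_iff forall_2 prod_eq_iff)

lemma inner_pt: "pt w \<bullet> pt w' = fst w * fst w' + snd w * snd w'"
  by (simp add: pt_def inner_vec_def sum_2)

lemma norm_pt: "norm (pt w) = sqrt (fst w ^ 2 + snd w ^ 2)"
  by (simp add: norm_eq_sqrt_inner inner_pt power2_eq_square)

text \<open>Complex multiplication by \<open>sgn (cos \<theta>) k (1 + i tan \<theta>)\<close>; the sign covers obtuse \<open>\<theta>\<close>.\<close>

definition turn :: "real \<Rightarrow> real \<Rightarrow> real \<times> real \<Rightarrow> real \<times> real" where
  "turn \<theta> k w = (sgn (cos \<theta>) * k * (fst w - tan \<theta> * snd w),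
                  sgn (cos \<theta>) * k * (snd w + tan \<theta> * fst w))"

text \<open>With \<open>r\<close> the squared length of \<open>w\<close>, the inner product is
  \<open>c * \<sigma> * k * r\<close> and the norms are \<open>c * sqrt r\<close> and
  \<open>k * sqrt r / \<bar>cos \<theta>\<bar>\<close>; the quotient is
  \<open>\<sigma> * \<bar>cos \<theta>\<bar> = cos \<theta>\<close>.\<close>

lemma vec_angle_turn:
  assumes \<theta>: "0 < \<theta>" "\<theta> < pi" "\<theta> \<noteq> pi / 2"
    and k: "k > 0" and c: "c > 0" and w: "w \<noteq> (0, 0)"
  shows "vec_angle (pt (c * fst w, c * snd w)) (pt (turn \<theta> k w)) = \<theta>"
proof -
  obtain x y where xy: "w = (x, y)" by (cases w)
  define r where "r = x\<^sup>2 + y\<^sup>2"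
  have r: "r > 0" using w by (simp add: r_def xy sum_power2_gt_zero_iff)
  have cos: "cos \<theta> \<noteq> 0" using \<theta> cos_inj_pi[of \<theta> "pi / 2"] by auto
  define \<sigma> where "\<sigma> = sgn (cos \<theta>)"
  have \<sigma>: "\<sigma>\<^sup>2 = 1" "\<sigma> * \<bar>cos \<theta>\<bar> = cos \<theta>"
    using cos by (auto simp: \<sigma>_def sgn_if abs_if)
  have inner: "pt (c * fst w, c * snd w) \<bullet> pt (turn \<theta> k w) = c * (\<sigma> * k) * r"
    by (simp add: inner_pt turn_def xy r_def \<sigma>_def power2_eq_square algebra_simps)
  have "norm (pt (c * fst w, c * snd w)) = sqrt (c\<^sup>2 * r)"
    by (simp add: norm_pt xy r_def algebra_simps)
  also have "\<dots> = c * sqrt r" using c by (simp add: real_sqrt_mult)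
  finally have n1: "norm (pt (c * fst w, c * snd w)) = c * sqrt r" .
  have "fst (turn \<theta> k w) ^ 2 + snd (turn \<theta> k w) ^ 2
      = \<sigma>\<^sup>2 * k\<^sup>2 * ((x - tan \<theta> * y)\<^sup>2 + (y + tan \<theta> * x)\<^sup>2)"
    by (simp add: turn_def xy \<sigma>_def power2_eq_square algebra_simps)
  also have "(x - tan \<theta> * y)\<^sup>2 + (y + tan \<theta> * x)\<^sup>2 = (1 + (tan \<theta>)\<^sup>2) * r"
    by (simp add: r_def power2_eq_square algebra_simps)
  also have "1 + (tan \<theta>)\<^sup>2 = (inverse (cos \<theta>))\<^sup>2" by (rule tan_sec[OF cos])
  finally have "norm (pt (turn \<theta> k w)) = sqrt ((k * inverse \<bar>cos \<theta>\<bar>)\<^sup>2 * r)"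
    by (simp add: norm_pt \<sigma> power_mult_distrib power_inverse)
  also have "\<dots> = k * sqrt r / \<bar>cos \<theta>\<bar>"
    using k by (simp add: real_sqrt_mult abs_mult divide_inverse mult_ac)
  finally have n2: "norm (pt (turn \<theta> k w)) = k * sqrt r / \<bar>cos \<theta>\<bar>" .
  have "norm (pt (c * fst w, c * snd w)) * norm (pt (turn \<theta> k w)) = c * k * r / \<bar>cos \<theta>\<bar>"
    using r by (simp add: n1 n2 field_simps)
  hence "vec_angle (pt (c * fst w, c * snd w)) (pt (turn \<theta> k w)) = arccos (\<sigma> * \<bar>cos \<theta>\<bar>)"
    unfolding vec_angle_def inner using r c k by simp
  thus ?thesis using \<theta> by (simp add: \<sigma> arccos_cos)
qed

text \<open>Multiplication by \<open>1 + i tan \<theta>\<close> is invertible, so the scaled vector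
  \<open>k * w\<close> can be recovered, though not \<open>k\<close> and \<open>w\<close>
  separately.\<close>

lemma turn_inj:
  assumes "cos \<theta> \<noteq> 0" and "turn \<theta> k w = turn \<theta> k' w'"
  shows "k * fst w = k' * fst w'" "k * snd w = k' * snd w'"
proof -
  define a where "a = k * fst w - k' * fst w'"
  define b where "b = k * snd w - k' * snd w'"
  have "sgn (cos \<theta>) \<noteq> 0" using assms(1) by (simp add: sgn_zero_iff)
  hence "k * (fst w - tan \<theta> * snd w) = k' * (fst w' - tan \<theta> * snd w')"
    "k * (snd w + tan \<theta> * fst w) = k' * (snd w' + tan \<theta> * fst w')"
    using assms(2) by (simp_all add: turn_def)
  hence 1: "a = tan \<theta> * b" and 2: "b = - tan \<theta> * a"
    by (simp_all add: a_def b_def algebra_simps)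
  have "a\<^sup>2 + b\<^sup>2 = a * (tan \<theta> * b) + b * (- tan \<theta> * a)"
    by (metis 1 2 power2_eq_square)
  hence "a\<^sup>2 + b\<^sup>2 = 0" by simp
  hence "a = 0" "b = 0" by (simp_all add: sum_power2_eq_zero_iff)
  thus "k * fst w = k' * fst w'" "k * snd w = k' * snd w'" by (simp_all add: a_def b_def)
qed

lemma determines_angle_pt:
  assumes \<theta>: "0 < \<theta>" "\<theta> < pi" "\<theta> \<noteq> pi / 2"
    and k: "k > 0" and c: "c > 0" and w: "w \<noteq> (0, 0)"
  shows "determines_angle \<theta> (pt p) (pt (p + (c * fst w, c * snd w))) (pt (p + turn \<theta> k w))"
proof -
  have angle: "vec_angle (pt (c * fst w, c * snd w)) (pt (turn \<theta> k w)) = \<theta>"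
    by (rule vec_angle_turn[OF assms])
  have 1: "(c * fst w, c * snd w) \<noteq> 0" using c w by (auto simp: prod_eq_iff zero_prod_def)
  have cos: "cos \<theta> \<noteq> 0" using \<theta> cos_inj_pi[of \<theta> "pi / 2"] by auto
  have 2: "turn \<theta> k w \<noteq> 0"
  proof
    assume "turn \<theta> k w = 0"
    hence "turn \<theta> k w = turn \<theta> k (0, 0)" by (simp add: turn_def zero_prod_def)
    from turn_inj[OF cos this] k w show False by (auto simp: prod_eq_iff)
  qed
  \<comment> \<open>Two equal nonzero arms would enclose the angle 0, against
    \<open>0 < \<theta>\<close>.\<close>
  have 3: "(c * fst w, c * snd w) \<noteq> turn \<theta> k w"
  proof
    assume eq: "(c * fst w, c * snd w) = turn \<theta> k w"
    have "pt (turn \<theta> k w) \<bullet> pt (turn \<theta> k w) = norm (pt (turn \<theta> k w)) * norm (pt (turn \<theta> k w))"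
      by (simp add: dot_square_norm power2_eq_square)
    moreover have "pt (turn \<theta> k w) \<noteq> 0"
      using 2 by simp
    ultimately have "vec_angle (pt (turn \<theta> k w)) (pt (turn \<theta> k w)) = 0"
      by (simp add: vec_angle_def)
    with angle eq \<theta> show False by simp
  qed
  show ?thesis
    unfolding determines_angle_def using 1 2 3 angle
    by (simp flip: pt_add)
qed

lemma finite_angle_triples:
  "finite P \<Longrightarrow> finite {(p, q, r). p \<in> P \<and> q \<in> P \<and> r \<in> P \<and> determines_angle \<theta> p q r}"
  by (rule finite_subset[of _ "P \<times> P \<times> P"]) auto

section \<open>Counting triples over all scales\<close>

context normed_order
begin

text \<open>Take \<open>B = A ^ (2 * d)\<close>. At scale \<open>A ^ j\<close> there are at least
  \<open>A ^ (2 * d * j)\<close> new ratios and \<open>A ^ (2 * d * (J - j))\<close> vectors. Each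
  of the \<open>J + 1\<close> scales thus contributes \<open>B ^ J\<close>, and the base points
  contribute another \<open>B ^ J\<close>.\<close>

lemma many_angle_triples:
  assumes \<theta>: "0 < \<theta>" "\<theta> < pi" "\<theta> \<noteq> pi / 2"
    and m: "m \<ge> 1" and tan: "of_nat m * tan \<theta> \<in> R"
  obtains K B :: nat where "K \<ge> 1" "B \<ge> 2"
    "\<And>J. \<exists>P. finite P \<and> card P \<le> K * B ^ J \<and> (J + 1) * B ^ (2 * J) \<le> angle_triples \<theta> P"
proof -
  define b where "b = of_nat m * tan \<theta>"
  \<comment> \<open>\<open>e\<close> bounds the growth under \<open>m * x - b * y\<close>.
    \<open>A\<close> bounds elements of \<open>near L\<close> by \<open>A * L\<close> and is also
    the step between scales, large enough for disjoint new ratios. \<open>Z\<close> collects the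
    losses in a product of \<open>l\<close> with a turned vector.\<close>
  define e where "e = m + C * nm b"
  define A where "A = 3 * C * s"
  define Z where "Z = C * A * e"
  define \<sigma> where "\<sigma> = sgn (cos \<theta>)"
  have cos: "cos \<theta> \<noteq> 0" using \<theta> cos_inj_pi[of \<theta> "pi / 2"] by auto
  have e: "e \<ge> 1" using m by (simp add: e_def)
  have A: "A \<ge> 2" using C_pos mult_le_mono[OF C_pos C_pos] by (simp add: A_def s_def)
  have Z: "Z \<ge> 1" using C_pos A e by (simp add: Z_def Suc_le_eq)
  have triples: "\<exists>P. finite P \<and> card P \<le> (5 * Z) ^ (2 * d) * (A ^ (2 * d)) ^ J
      \<and> (J + 1) * (A ^ (2 * d)) ^ (2 * J) \<le> angle_triples \<theta> P" for J
  proof -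
    define N where "N = Z * A ^ J"
    \<comment> \<open>Base points and displacements both lie in boxes of size \<open>N\<close>,
      hence the size \<open>2 * N\<close>.\<close>
    define P where "P = pt ` (Box (2 * N) \<times> Box (2 * N))"
    define T where "T j = new_ratios (A ^ j)" for j
    define V where "V j = Box (A ^ (J - j)) \<times> Box (A ^ (J - j)) - {(0, 0)}" for j
    \<comment> \<open>One representing pair is fixed for each ratio, so that the triples are indexed
      by ratios.\<close>
    define lm where "lm j t = (SOME p. p \<in> near (A ^ j) \<times> near (A ^ j) \<and> t = fst p / snd p)" for j t
    define l where "l j t = fst (lm j t)" for j t
    define n where "n j t = snd (lm j t)" for j t
    have Aj: "A ^ j \<ge> 1" for j using A by simp
    have ln: "l j t \<in> near (A ^ j)" "n j t \<in> near (A ^ j)" "t = l j t / n j t" if "t \<in> T j" for j t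
    proof -
      have "\<exists>p. p \<in> near (A ^ j) \<times> near (A ^ j) \<and> t = fst p / snd p"
        using that by (auto simp: T_def new_ratios_def ratios_def)
      from someI_ex[OF this, folded lm_def]
      show "l j t \<in> near (A ^ j)" "n j t \<in> near (A ^ j)" "t = l j t / n j t"
        by (auto simp: l_def n_def)
    qed
    have pos: "l j t > 0" "n j t > 0" if "t \<in> T j" for j t
      using near_pos ln[OF that] Aj by blast+
    have T_disj: "j = j'" if "t \<in> T j" "t \<in> T j'" for j j' t
    proof -
      have *: False if "i < i'" "t \<in> T i" "t \<in> T i'" for i i'
      proof -
        have "A ^ Suc i \<le> A ^ i'" using that A by (intro power_increasing) auto
        hence "3 * C * s * A ^ i \<le> 2 * A ^ i'" by (simp add: A_def)
        from new_ratios_disjoint[OF Aj this] that show False by (auto simp: T_def)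
      qed
      show ?thesis using *[of j j'] *[of j' j] that by (cases j j' rule: linorder_cases) auto
    qed
    define I where "I = (SIGMA j:{..J}. T j \<times> V j)"
    define f where "f = (\<lambda>(p, j, t, w). (pt p, pt (p + (n j t * fst w, n j t * snd w)),
        pt (p + turn \<theta> (l j t * real m) w)))"
    \<comment> \<open>A triple gives \<open>p\<close>, \<open>n * w\<close> and
      \<open>l * w\<close>. The quotient at a nonzero coordinate of \<open>w\<close> is
      \<open>t\<close>; since \<open>t\<close> is new at one scale only, it determines
      \<open>j\<close>, then \<open>n\<close>, then \<open>w\<close>.\<close>
    have inj: "inj_on f ((Box N \<times> Box N) \<times> I)"
    proof (rule inj_onI)
      fix i i' assume i: "i \<in> (Box N \<times> Box N) \<times> I" "i' \<in> (Box N \<times> Box N) \<times> I" and eq: "f i = f i'"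
      obtain p j t w where 1: "i = (p, j, t, w)" by (metis prod.exhaust)
      obtain p' j' t' w' where 2: "i' = (p', j', t', w')" by (metis prod.exhaust)
      have T: "t \<in> T j" "t' \<in> T j'" and w: "w \<noteq> (0, 0)" using i by (auto simp: 1 2 I_def V_def)
      have p: "p = p'" and n: "n j t * fst w = n j' t' * fst w'" "n j t * snd w = n j' t' * snd w'"
        and tu: "turn \<theta> (l j t * real m) w = turn \<theta> (l j' t' * real m) w'"
        using eq by (auto simp: f_def 1 2)
      have l: "l j t * fst w = l j' t' * fst w'" "l j t * snd w = l j' t' * snd w'"
        using turn_inj[OF cos tu] m by (auto simp: mult_ac)
      have tt: "t = t'" if "n j t * x = n j' t' * x'" "l j t * x = l j' t' * x'" "x \<noteq> 0" for x x'
      proof -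
        have "x' \<noteq> 0" using that pos[OF T(1)] by auto
        have "t = (l j t * x) / (n j t * x)" using ln(3)[OF T(1)] that(3) by simp
        also have "\<dots> = t'" unfolding that(1,2) using ln(3)[OF T(2)] \<open>x' \<noteq> 0\<close> by simp
        finally show ?thesis .
      qed
      have t: "t = t'" using tt[OF n(1) l(1)] tt[OF n(2) l(2)] w by (auto simp: prod_eq_iff)
      with T T_disj have j: "j = j'" by blast
      have "w = w'" using n pos[OF T(1)] by (simp add: t j prod_eq_iff)
      with p t j show "i = i'" by (simp add: 1 2)
    qed
    have sub: "f ` ((Box N \<times> Box N) \<times> I)
        \<subseteq> {(p, q, r). p \<in> P \<and> q \<in> P \<and> r \<in> P \<and> determines_angle \<theta> p q r}"
    proof (rule image_subsetI)
      fix i assume i: "i \<in> (Box N \<times> Box N) \<times> I"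
      obtain px py j t x y where 1: "i = ((px, py), j, t, (x, y))" by (metis prod.exhaust)
      have T: "t \<in> T j" and j: "j \<le> J" and w: "(x, y) \<noteq> (0, 0)"
        and p: "px \<in> Box N" "py \<in> Box N"
        and xy: "x \<in> Box (A ^ (J - j))" "y \<in> Box (A ^ (J - j))"
        using i by (auto simp: 1 I_def V_def)
      let ?W = "A ^ (J - j)"
      have lB: "l j t \<in> Box (A * A ^ j)" and nB: "n j t \<in> Box (A * A ^ j)"
        using nm_near ln[OF T] near_mem by (auto simp: Box_def A_def)
      have AJ: "A ^ j * ?W = A ^ J" using j by (simp flip: power_add)
      have lw: "l j t * z \<in> Box N" if "z \<in> Box (e * ?W)" for z
        using Box_mult[OF lB that] AJ by (simp add: N_def Z_def mult_ac)
      have nw: "n j t * z \<in> Box N" if "z \<in> Box ?W" for z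
      proof -
        have "C * (A * A ^ j) * ?W = C * A * 1 * A ^ J" by (simp add: AJ[symmetric] mult_ac)
        also have "\<dots> \<le> C * A * e * A ^ J" using e by (intro mult_mono) auto
        finally have "C * (A * A ^ j) * ?W \<le> N" by (simp only: N_def Z_def)
        with Box_mult[OF nB that] Box_mono show ?thesis by blast
      qed
      have b: "b \<in> Box (nm b)" using tan by (simp add: Box_def b_def)
      have mz: "of_nat m * z \<in> Box (m * ?W)" if "z \<in> Box ?W" for z
      proof -
        have "nm (of_nat m * z) = m * nm z" using that by (intro nm_of_nat_mult) (simp add: Box_def)
        thus ?thesis using that of_nat_mem mult_mem by (auto simp: Box_def)
      qed
      have e_eq: "e * ?W = m * ?W + C * nm b * ?W" by (simp add: e_def algebra_simps)
      have t1: "l j t * (of_nat m * x - b * y) \<in> Box N"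
        by (rule lw, unfold e_eq, intro Box_diff mz Box_mult xy b)
      have t2: "l j t * (of_nat m * y + b * x) \<in> Box N"
        by (rule lw, unfold e_eq, intro Box_add mz Box_mult xy b)
      have sg: "\<sigma> * z \<in> Box N" if "z \<in> Box N" for z
        using that Box_minus[OF that] by (auto simp: \<sigma>_def sgn_if)
      \<comment> \<open>The factor \<open>m\<close> clears \<open>tan \<theta>\<close> to
        \<open>b\<close>, so both coordinates become products of ring elements up to the sign
        \<open>\<sigma>\<close>.\<close>
      have turn: "turn \<theta> (l j t * real m) (x, y)
          = (\<sigma> * (l j t * (of_nat m * x - b * y)), \<sigma> * (l j t * (of_nat m * y + b * x)))"
        by (simp add: turn_def \<sigma>_def b_def algebra_simps)
      have PI: "pt ((px, py) + (u, v)) \<in> P" if "u \<in> Box N" "v \<in> Box N" for u v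
        using that p Box_add[of px N u N] Box_add[of py N v N] by (auto simp: P_def mult_2)
      have "pt (px, py) \<in> P" using PI[of 0 0] by simp
      moreover have "pt ((px, py) + (n j t * x, n j t * y)) \<in> P" by (intro PI nw xy)
      moreover have "pt ((px, py) + turn \<theta> (l j t * real m) (x, y)) \<in> P"
        unfolding turn by (intro PI sg t1 t2)
      moreover have "determines_angle \<theta> (pt (px, py)) (pt ((px, py) + (n j t * x, n j t * y)))
          (pt ((px, py) + turn \<theta> (l j t * real m) (x, y)))"
        using determines_angle_pt[OF \<theta> _ pos(2)[OF T] w, of "l j t * real m" "(px, py)"]
          pos(1)[OF T] m
        by simp
      ultimately show "f i \<in> {(p, q, r). p \<in> P \<and> q \<in> P \<and> r \<in> P \<and> determines_angle \<theta> p q r}"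
        by (simp add: f_def 1)
    qed
    have fP: "finite P" by (simp add: P_def)
    have "card (Box N \<times> Box N) * card I \<le> angle_triples \<theta> P"
      unfolding angle_triples_def card_cartesian_product[symmetric]
      by (rule card_inj_on_le[OF inj sub finite_angle_triples[OF fP]])
    moreover have card_N: "(A ^ (2 * d)) ^ J \<le> card (Box N \<times> Box N)"
    proof -
      have "(A ^ (2 * d)) ^ J = (1 * A ^ J) ^ (2 * d)"
        by (simp add: power_mult[symmetric] mult_ac)
      also have "\<dots> \<le> (2 * N + 1) ^ (2 * d)"
        using mult_le_mono1[OF Z, of "A ^ J"] by (intro power_mono) (unfold N_def, linarith, simp)
      also have "\<dots> = card (Box N \<times> Box N)"
        by (simp add: card_cartesian_product card_Box mult_2 power_add)
      finally show ?thesis .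
    qed
    moreover have card_I: "(J + 1) * (A ^ (2 * d)) ^ J \<le> card I"
    proof -
      have "(A ^ (2 * d)) ^ J \<le> card (T j \<times> V j)" if "j \<le> J" for j
      proof -
        let ?W = "A ^ (J - j)"
        \<comment> \<open>The strict inequality pays for removing the zero vector from
          \<open>V j\<close>.\<close>
        have "?W ^ (2 * d) < (2 * ?W + 1) ^ (2 * d)" using d_pos by (intro power_strict_mono) auto
        also have "\<dots> = card (Box ?W \<times> Box ?W)"
          by (simp add: card_cartesian_product card_Box mult_2 power_add)
        also have "\<dots> = Suc (card (V j))"
          unfolding V_def by (rule card.remove) auto
        finally have "?W ^ (2 * d) \<le> card (V j)" by simp
        moreover have "(A ^ j) ^ (2 * d) \<le> card (T j)"
          unfolding T_def by (rule card_new_ratios[OF Aj])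
        ultimately have "(A ^ j) ^ (2 * d) * ?W ^ (2 * d) \<le> card (T j) * card (V j)"
          by (intro mult_le_mono)
        \<comment> \<open>The powers for ratios and vectors multiply to a quantity independent of
          \<open>j\<close>, so summation over the scales yields the factor
          \<open>J + 1\<close>.\<close>
        moreover have "(A ^ j) ^ (2 * d) * ?W ^ (2 * d) = (A ^ J) ^ (2 * d)"
          using that by (simp flip: power_mult_distrib power_add)
        ultimately show ?thesis by (simp add: card_cartesian_product power_mult[symmetric] mult_ac)
      qed
      hence "(\<Sum>j\<le>J. (A ^ (2 * d)) ^ J) \<le> (\<Sum>j\<le>J. card (T j \<times> V j))"
        by (intro sum_mono) auto
      also have "\<dots> = card I"
        unfolding I_def by (subst card_SigmaI) (auto simp: T_def V_def new_ratios_def finite_ratios)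
      finally show ?thesis by simp
    qed
    ultimately have "(A ^ (2 * d)) ^ J * ((J + 1) * (A ^ (2 * d)) ^ J) \<le> angle_triples \<theta> P"
      using mult_le_mono[OF card_N card_I] by linarith
    moreover have "(A ^ (2 * d)) ^ J * ((J + 1) * (A ^ (2 * d)) ^ J) = (J + 1) * (A ^ (2 * d)) ^ (2 * J)"
      unfolding mult_2[of J] power_add by (simp only: mult_ac)
    moreover have "card P \<le> (5 * Z) ^ (2 * d) * (A ^ (2 * d)) ^ J"
    proof -
      have "card P \<le> card (Box (2 * N) \<times> Box (2 * N))"
        unfolding P_def by (rule card_image_le) simp
      also have "\<dots> = (2 * (2 * N) + 1) ^ (2 * d)"
        by (simp add: card_cartesian_product card_Box mult_2 power_add)
      also have "\<dots> \<le> (5 * N) ^ (2 * d)"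
        using mult_le_mono[OF Z Aj[of J]] by (intro power_mono) (unfold N_def, linarith, simp)
      also have "\<dots> = (5 * Z) ^ (2 * d) * (A ^ (2 * d)) ^ J"
        by (simp add: N_def power_mult_distrib power_mult[symmetric] mult_ac)
      finally show ?thesis .
    qed
    ultimately show ?thesis using fP by (intro exI[of _ P]) simp
  qed
  show ?thesis
  proof (rule that[OF _ _ triples])
    show "1 \<le> (5 * Z) ^ (2 * d)" using Z by simp
    have "2 ^ 1 \<le> (2::nat) ^ (2 * d)" using d_pos by (intro power_increasing) auto
    also have "\<dots> \<le> A ^ (2 * d)" using A by (intro power_mono) auto
    finally show "2 \<le> A ^ (2 * d)" by simp
  qed
qed

end

section \<open>From geometric sizes to every \<open>n\<close>\<close>

text \<open>This serves the values of \<open>n\<close> below the constant \<open>K\<close>, where a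
  single triple suffices once \<open>c\<close> is small.\<close>

lemma one_angle_triple:
  assumes "0 < \<theta>" "\<theta> < pi" "\<theta> \<noteq> pi / 2"
  shows "\<exists>P. finite P \<and> card P \<le> 3 \<and> 1 \<le> angle_triples \<theta> P"
proof -
  define w :: "real \<times> real" where "w = (1, 0)"
  let ?p = "pt 0" and ?q = "pt (0 + (1 * fst w, 1 * snd w))" and ?r = "pt (0 + turn \<theta> 1 w)"
  let ?P = "{?p, ?q, ?r}"
  have "determines_angle \<theta> ?p ?q ?r"
    by (rule determines_angle_pt) (use assms in \<open>auto simp: w_def\<close>)
  hence "(?p, ?q, ?r) \<in> {(p, q, r). p \<in> ?P \<and> q \<in> ?P \<and> r \<in> ?P \<and> determines_angle \<theta> p q r}"
    by simp
  hence "1 \<le> angle_triples \<theta> ?P"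
    unfolding angle_triples_def using finite_angle_triples[of ?P \<theta>]
    by (metis (no_types, lifting) One_nat_def Suc_leI card_gt_0_iff empty_iff finite.emptyI finite.insertI)
  moreover have "card ?P \<le> 3" using card_length[of "[?p, ?q, ?r]"] by simp
  ultimately show ?thesis by (intro exI[of _ ?P] conjI) simp_all
qed

text \<open>\<open>J\<close> is the predecessor of the least exponent at which
  \<open>K * B ^ j\<close> exceeds \<open>n\<close>; \<open>n \<ge> K\<close> makes that exponent
  positive.\<close>

lemma geometric_scale:
  fixes K B n :: nat
  assumes "K \<ge> 1" "B \<ge> 2" "n \<ge> K"
  obtains J where "K * B ^ J \<le> n" "n < K * B ^ (J + 1)"
proof -
  have "n < 2 ^ n" by simp
  also have "\<dots> \<le> B ^ n" using assms by (intro power_mono) auto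
  also have "\<dots> \<le> K * B ^ n" using assms by simp
  finally have ex: "\<exists>j. n < K * B ^ j" ..
  define i where "i = (LEAST j. n < K * B ^ j)"
  have i: "n < K * B ^ i" unfolding i_def by (rule LeastI_ex[OF ex])
  with assms have "i \<noteq> 0" by (cases "i = 0") auto
  then obtain J where J: "i = Suc J" by (cases i) auto
  have "\<not> n < K * B ^ J" using not_less_Least[of J "\<lambda>j. n < K * B ^ j"] J by (simp add: i_def)
  with i J show ?thesis by (intro that[of J]) auto
qed

theorem mainTheorem1:
  fixes \<theta> :: real
  assumes "0 < \<theta>" and "\<theta> < pi" and "\<theta> \<noteq> pi / 2"
    and "algebraic (tan \<theta>)"
  shows "\<exists>c > 0. \<forall>n::nat. n \<ge> 3 \<longrightarrow>
           (\<exists>P :: (real^2) set. finite P \<and> card P \<le> n \<and>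
              real (angle_triples \<theta> P) \<ge> c * (real n)^2 * ln (real n))"
proof -
  obtain R nm d C and m :: nat where "normed_order R nm d C" "m \<ge> 1" "of_nat m * tan \<theta> \<in> R"
    using algebraic_imp_normed_order[OF assms(4)] .
  then obtain K B :: nat where K: "K \<ge> 1" and B: "B \<ge> 2" and
    P: "\<And>J. \<exists>P. finite P \<and> card P \<le> K * B ^ J \<and> (J + 1) * B ^ (2 * J) \<le> angle_triples \<theta> P"
    using normed_order.many_angle_triples[of R nm d C \<theta> m] assms by blast
  \<comment> \<open>The squares pay for \<open>n \<le> K * B ^ (J + 1)\<close>, and
    \<open>K + B\<close> pays for \<open>ln n \<le> (J + 1) * (K + B)\<close>.\<close>
  define c where "c = 1 / (real K ^ 2 * real B ^ 2 * real (K + B))"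
  have c: "c > 0" using K B by (simp add: c_def)
  have ln_le: "ln (real x) \<le> real x" if "x > 0" for x
    using ln_le_minus_one[of "real x"] that by simp
  show ?thesis
  proof (intro exI[of _ c] conjI allI impI c)
    fix n :: nat assume n: "n \<ge> 3"
    show "\<exists>P :: (real^2) set. finite P \<and> card P \<le> n \<and> real (angle_triples \<theta> P) \<ge> c * (real n)^2 * ln (real n)"
    proof (cases "n \<ge> K")
      case False
      \<comment> \<open>For \<open>n < K\<close> the target is at most \<open>c * K ^ 3\<close>,
        which the choice of \<open>c\<close> keeps below or equal to 1.\<close>
      have "c * (real n)^2 * ln (real n) \<le> c * (real K)^2 * real K"
        using False n c ln_le[of n] by (intro mult_mono) auto
      also have "\<dots> = real K / (real B ^ 2 * real (K + B))" using K by (simp add: c_def)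
      also have "\<dots> \<le> 1"
      proof -
        have "1 * real K \<le> real B ^ 2 * real (K + B)" using B by (intro mult_mono) auto
        thus ?thesis using K B by (simp add: divide_le_eq_1)
      qed
      finally have "c * (real n)^2 * ln (real n) \<le> 1" .
      moreover obtain P where "finite P" "card P \<le> 3" "1 \<le> angle_triples \<theta> P"
        using one_angle_triple assms by blast
      ultimately show ?thesis using n by (intro exI[of _ P]) auto
    next
      case True
      obtain J where J: "K * B ^ J \<le> n" "n < K * B ^ (J + 1)" using geometric_scale[OF K B True] .
      obtain P where P: "finite P" "card P \<le> K * B ^ J" "(J + 1) * B ^ (2 * J) \<le> angle_triples \<theta> P"
        using P by blast
      have nle: "real n \<le> real K * real B ^ (J + 1)"
        using J(2) by (metis less_imp_le of_nat_le_iff of_nat_mult of_nat_power)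
      have "ln (real n) \<le> ln (real K * real B ^ (J + 1))" using nle n by simp
      also have "\<dots> = ln (real K) + real (J + 1) * ln (real B)"
        using K B by (simp add: ln_mult ln_realpow algebra_simps)
      also have "ln (real K) \<le> real (J + 1) * real K"
        using ln_le[of K] K mult_right_mono[of 1 "real (J + 1)" "real K"] by linarith
      also have "real (J + 1) * ln (real B) \<le> real (J + 1) * real B"
        using ln_le[of B] B by (intro mult_left_mono) auto
      finally have "ln (real n) \<le> real (J + 1) * real (K + B)"
        by (simp only: of_nat_add distrib_left)
      hence "c * (real n)^2 * ln (real n)
          \<le> c * (real K * real B ^ (J + 1))^2 * (real (J + 1) * real (K + B))"
        using nle n c by (intro mult_mono power_mono) auto
      also have "\<dots> = real ((J + 1) * B ^ (2 * J))"
      proof -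
        have cancel: "1 / (k\<^sup>2 * b\<^sup>2 * e) * (k * (b * z))\<^sup>2 * (j * e) = j * z\<^sup>2"
          if "k > 0" "b > 0" "e > 0" for k b e z j :: real
          using that by (simp add: power_mult_distrib)
        have square: "real ((J + 1) * B ^ (2 * J)) = real (J + 1) * (real B ^ J)\<^sup>2"
          by (simp only: of_nat_mult of_nat_power power_even_eq)
        have step: "real B ^ (J + 1) = real B * real B ^ J" by simp
        show ?thesis unfolding square step c_def using K B by (intro cancel) auto
      qed
      also have "\<dots> \<le> real (angle_triples \<theta> P)" using P(3) by (simp only: of_nat_le_iff)
      finally show ?thesis using P J by (intro exI[of _ P]) auto
    qed
  qed
qed

end
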